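(* Let $G_1=(V_1,E_1)$ and $G_2=(V_2,E_2)$ be edge-weighted graphs with real weights, with $|V_1|=n_1$ and $|V_2|=n_2$. Let $(X_1,S_1)$ be a pair consisting of an optimal primal and an optimal dual solution of the max-cut SDP of $G_1$, and let $(X_2,S_2)$ be such a pair for $G_2$. Let $G'$ be the vertex sum of $G_1$ and $G_2$ obtained by identifying the last vertex of $V_1$ with the first vertex of $V_2$; its $n_1+n_2-1$ vertices are ordered with those of $V_1$ first (in order), the last of them being the shared vertex, followed by the remaining vertices of $V_2$ (in order). Write $$X_1=\begin{bmatrix} Y_1 & y_1\\ y_1^T & 1\end{bmatrix},\qquad X_2=\begin{bmatrix} 1 & y_2^T\\ y_2 & Y_2\end{bmatrix},$$ where $y_1\in\mathbb{R}^{n_1-1}$ and $y_2\in\mathbb{R}^{n_2-1}$ are column vectors. Define the $(n_1+n_2-1)\times(n_1+n_2-1)$ matrices $$X'=\begin{bmatrix} Y_1 & y_1 & y_1y_2^T\\ y_1^T & 1 & y_2^T\\ y_2y_1^T & y_2 & Y_2\end{bmatrix},\qquad S'=\begin{bmatrix} S_1 & 0\\ 0 & 0\end{bmatrix}+\begin{bmatrix} 0 & 0\\ 0 & S_2\end{bmatrix},$$ where in $S'$ the block $S_1$ occupies the first $n_1$ rows and columns and the block $S_2$ occupies the last $n_2$ rows and columns (so the two blocks overlap exactly in the diagonal entry of the shared vertex). Then $X'$ is an optimal primal solution and $S'$ is an optimal dual solution of the max-cut SDP of $G'$. Furthermore, $\operatorname{rank}X'=\operatorname{rank}X_1+\ope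ratorname{rank}X_2-1$.
   Context: For a graph $G=([n],E)$ with real edge weights $\{w_{ij}\}_{ij\in E}$, the Laplacian $L(G,w)$ is the symmetric $n\times n$ matrix with $L(G,w)_{ij}=-w_{ij}$ if $ij\in E$, $L(G,w)_{ii}=\sum_{k: ik\in E} w_{ik}$, and all other entries $0$. Put $C=\frac14 L(G,w)$. The primal max-cut SDP of $G$ is: maximize $\operatorname{Tr}(CX)$ over real symmetric $n\times n$ matrices $X$ subject to $X_{ii}=1$ for all $i\in[n]$ and $X\succeq0$. The dual max-cut SDP is: minimize $\sum_i y_i$ over $y\in\mathbb{R}^n$ and symmetric $S$ subject to $S=\operatorname{Diag}(y)-C$ and $S\succeq0$; a matrix $S$ is called an optimal dual solution if it is the $S$-part of an optimal $(y,S)$. The vertex sum of two weighted graphs is the graph obtained by taking their disjoint union and identifying one chosen vertex of the first with one chosen vertex of the second; every edge of the result comes from exactly one of the two graphs and keeps its weight. *)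

theory Defs
  imports
    "Graph_Theory.Pair_Digraph"
    "Graph_Theory.Weighted_Graph"
    "Jordan_Normal_Form.DL_Rank"
begin

text \<open>
  An undirected edge \<open>ij\<close> is the pair of arcs \<open>(i, j)\<close>, \<open>(j, i)\<close> of a \<^locale>\<open>pair_graph\<close>
  (finite, symmetric, loop-free), both carrying its weight. The vertex set \<open>[n]\<close> is \<open>{0..<n}\<close>,
  so that vertices index the rows and columns of matrices.
\<close>

definition weighted_graph ::
    "nat \<Rightarrow> nat pair_pre_digraph \<Rightarrow> (nat \<times> nat) weight_fun \<Rightarrow> bool" where
  "weighted_graph n G w \<longleftrightarrow>
     pair_graph G \<and> pverts G = {0..<n} \<and> (\<forall>(i, j) \<in> parcs G. w (i, j) = w (j, i))"

definition laplacian ::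
    "nat \<Rightarrow> nat pair_pre_digraph \<Rightarrow> (nat \<times> nat) weight_fun \<Rightarrow> real mat" where
  "laplacian n G w = mat n n (\<lambda>(i, j).
     if i = j then (\<Sum>k \<in> {k. (i, k) \<in> parcs G}. w (i, k))
     else if (i, j) \<in> parcs G then - w (i, j)
     else 0)"

definition maxcut_cost ::
    "nat \<Rightarrow> nat pair_pre_digraph \<Rightarrow> (nat \<times> nat) weight_fun \<Rightarrow> real mat" where
  "maxcut_cost n G w = (1 / 4) \<cdot>\<^sub>m laplacian n G w"

definition mat_trace :: "real mat \<Rightarrow> real" where
  "mat_trace A = (\<Sum>i<dim_row A. A $$ (i, i))"

definition psd_mat :: "nat \<Rightarrow> real mat \<Rightarrow> bool" where
  "psd_mat n A \<longleftrightarrow>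
     A \<in> carrier_mat n n \<and> transpose_mat A = A \<and>
     (\<forall>x \<in> carrier_vec n. 0 \<le> x \<bullet> (A *\<^sub>v x))"

definition primal_feasible :: "nat \<Rightarrow> real mat \<Rightarrow> bool" where
  "primal_feasible n X \<longleftrightarrow> psd_mat n X \<and> (\<forall>i<n. X $$ (i, i) = 1)"

definition optimal_primal_solution ::
    "nat \<Rightarrow> nat pair_pre_digraph \<Rightarrow> (nat \<times> nat) weight_fun \<Rightarrow> real mat \<Rightarrow> bool" where
  "optimal_primal_solution n G w X \<longleftrightarrow>
     primal_feasible n X \<and>
     (\<forall>Z. primal_feasible n Z \<longrightarrow>
        mat_trace (maxcut_cost n G w * Z) \<le> mat_trace (maxcut_cost n G w * X))"

definition dual_feasible ::
    "nat \<Rightarrow> nat pair_pre_digraph \<Rightarrow> (nat \<times> nat) weight_fun \<Rightarrow> real vec \<Rightarrow> real mat \<Rightarrow> bool" where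
  "dual_feasible n G w y S \<longleftrightarrow>
     y \<in> carrier_vec n \<and> psd_mat n S \<and> S = mat_diag n (\<lambda>i. y $ i) - maxcut_cost n G w"

definition optimal_dual_solution ::
    "nat \<Rightarrow> nat pair_pre_digraph \<Rightarrow> (nat \<times> nat) weight_fun \<Rightarrow> real mat \<Rightarrow> bool" where
  "optimal_dual_solution n G w S \<longleftrightarrow>
     (\<exists>y. dual_feasible n G w y S \<and>
        (\<forall>z T. dual_feasible n G w z T \<longrightarrow> (\<Sum>i<n. y $ i) \<le> (\<Sum>i<n. z $ i)))"

text \<open>
  The vertex sum of graphs on \<open>{0..<n\<^sub>1}\<close> and \<open>{0..<n\<^sub>2}\<close>, \<open>n\<^sub>1, n\<^sub>2 > 0\<close>, identifying vertex
  \<open>n\<^sub>1 - 1\<close> of the first with vertex \<open>0\<close> of the second: vertex \<open>v\<close> of the second graph becomes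
  \<open>v + (n\<^sub>1 - 1)\<close>. As the two vertex sets then meet in \<open>n\<^sub>1 - 1\<close> only and there are no loops,
  no arc comes from both graphs.
\<close>

definition vertex_sum ::
    "nat \<Rightarrow> nat pair_pre_digraph \<Rightarrow> nat pair_pre_digraph \<Rightarrow> nat pair_pre_digraph" where
  "vertex_sum n1 G1 G2 =
     \<lparr> pverts = pverts G1 \<union> (\<lambda>v. v + (n1 - 1)) ` pverts G2,
       parcs = parcs G1 \<union> (\<lambda>(i, j). (i + (n1 - 1), j + (n1 - 1))) ` parcs G2 \<rparr>"

definition vertex_sum_weight ::
    "nat \<Rightarrow> nat pair_pre_digraph \<Rightarrow> (nat \<times> nat) weight_fun \<Rightarrow> (nat \<times> nat) weight_fun \<Rightarrow>
     (nat \<times> nat) weight_fun" where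
  "vertex_sum_weight n1 G1 w1 w2 = (\<lambda>(i, j).
     if (i, j) \<in> parcs G1 then w1 (i, j) else w2 (i - (n1 - 1), j - (n1 - 1)))"

lemma weighted_graph_vertex_sum:
  assumes G1: "weighted_graph n1 G1 w1" and G2: "weighted_graph n2 G2 w2"
    and n1: "0 < n1" and n2: "0 < n2"
  shows "weighted_graph (n1 + n2 - 1) (vertex_sum n1 G1 G2) (vertex_sum_weight n1 G1 w1 w2)"
    and "(i, j) \<in> parcs G1 \<Longrightarrow> vertex_sum_weight n1 G1 w1 w2 (i, j) = w1 (i, j)"
    and "(i, j) \<in> parcs G2 \<Longrightarrow>
           vertex_sum_weight n1 G1 w1 w2 (i + (n1 - 1), j + (n1 - 1)) = w2 (i, j)"
proof -
  interpret g1: pair_graph G1 using G1 by (simp add: weighted_graph_def)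
  interpret g2: pair_graph G2 using G2 by (simp add: weighted_graph_def)
  have V1: "pverts G1 = {0..<n1}" and V2: "pverts G2 = {0..<n2}"
    and w1: "\<And>i j. (i, j) \<in> parcs G1 \<Longrightarrow> w1 (i, j) = w1 (j, i)"
    and w2: "\<And>i j. (i, j) \<in> parcs G2 \<Longrightarrow> w2 (i, j) = w2 (j, i)"
    using G1 G2 by (auto simp: weighted_graph_def)
  have a1: "i < n1 \<and> j < n1 \<and> i \<noteq> j \<and> (j, i) \<in> parcs G1" if "(i, j) \<in> parcs G1" for i j
    using g1.in_arcsD1[OF that] g1.in_arcsD2[OF that] g1.pair_no_loops[OF that]
      g1.pair_sym_arcs that V1 by (auto simp: symmetric_def sym_def)
  have a2: "i < n2 \<and> j < n2 \<and> i \<noteq> j \<and> (j, i) \<in> parcs G2" if "(i, j) \<in> parcs G2" for i j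
    using g2.in_arcsD1[OF that] g2.in_arcsD2[OF that] g2.pair_no_loops[OF that]
      g2.pair_sym_arcs that V2 by (auto simp: symmetric_def sym_def)
  have disj: "(i + (n1 - 1), j + (n1 - 1)) \<notin> parcs G1" if "(i, j) \<in> parcs G2" for i j
    using a1[of "i + (n1 - 1)" "j + (n1 - 1)"] a2[OF that] by fastforce
  show W1: "(i, j) \<in> parcs G1 \<Longrightarrow> vertex_sum_weight n1 G1 w1 w2 (i, j) = w1 (i, j)" for i j
    by (simp add: vertex_sum_weight_def)
  show W2: "(i, j) \<in> parcs G2 \<Longrightarrow>
      vertex_sum_weight n1 G1 w1 w2 (i + (n1 - 1), j + (n1 - 1)) = w2 (i, j)" for i j
    using disj by (simp add: vertex_sum_weight_def)
  let ?G = "vertex_sum n1 G1 G2"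
  have V: "pverts ?G = {0..<n1 + n2 - 1}"
  proof -
    have "(\<lambda>v. v + (n1 - 1)) ` {0..<n2} = {n1 - 1..<n1 + n2 - 1}"
      using n1 n2 image_add_atLeastLessThan'[of "n1 - 1" 0 n2] by (simp add: add.commute)
    then show ?thesis using V1 V2 n1 n2 by (auto simp: vertex_sum_def)
  qed
  have E: "i < n1 + n2 - 1 \<and> j < n1 + n2 - 1 \<and> i \<noteq> j \<and> (j, i) \<in> parcs ?G
      \<and> vertex_sum_weight n1 G1 w1 w2 (i, j) = vertex_sum_weight n1 G1 w1 w2 (j, i)"
    if ij: "(i, j) \<in> parcs ?G" for i j
  proof -
    consider "(i, j) \<in> parcs G1"
      | k l where "(k, l) \<in> parcs G2" "i = k + (n1 - 1)" "j = l + (n1 - 1)"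
      using ij by (auto simp: vertex_sum_def)
    then show ?thesis
    proof cases
      case 1
      with a1[OF 1] n2 W1[of i j] W1[of j i] w1[OF 1] show ?thesis
        by (auto simp: vertex_sum_def)
    next
      case 2
      with a2[OF 2(1)] n1 W2[of k l] W2[of l k] w2[OF 2(1)] show ?thesis
        by (auto simp: vertex_sum_def intro!: rev_image_eqI[of "(l, k)"])
    qed
  qed
  have fin: "finite (parcs ?G)"
    by (simp add: vertex_sum_def g1.pair_finite_arcs g2.pair_finite_arcs)
  have "pair_graph ?G"
    using E V fin by unfold_locales (auto simp: symmetric_def sym_def)
  then show "weighted_graph (n1 + n2 - 1) ?G (vertex_sum_weight n1 G1 w1 w2)"
    using V E by (auto simp: weighted_graph_def)
qed

definition append_cols :: "'a :: zero mat \<Rightarrow> 'a mat \<Rightarrow> 'a mat" where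
  "append_cols A B = four_block_mat A B (0\<^sub>m 0 (dim_col A)) (0\<^sub>m 0 (dim_col B))"

text \<open>The column vectors \<open>y1\<close>, \<open>y2\<close> are matrices with one column.\<close>

definition glue_primal :: "real mat \<Rightarrow> real mat \<Rightarrow> real mat \<Rightarrow> real mat \<Rightarrow> real mat" where
  "glue_primal Y1 y1 y2 Y2 =
     four_block_mat
       (four_block_mat Y1 y1
                       (transpose_mat y1) (1\<^sub>m 1))
       (append_rows (y1 * transpose_mat y2)
                    (transpose_mat y2))
       (append_cols (y2 * transpose_mat y1) y2)
       Y2"

definition glue_dual :: "nat \<Rightarrow> nat \<Rightarrow> real mat \<Rightarrow> real mat \<Rightarrow> real mat" where
  "glue_dual n1 n2 S1 S2 =
     four_block_mat S1 (0\<^sub>m n1 (n2 - 1))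
                    (0\<^sub>m (n2 - 1) n1) (0\<^sub>m (n2 - 1) (n2 - 1))
     + four_block_mat (0\<^sub>m (n1 - 1) (n1 - 1)) (0\<^sub>m (n1 - 1) n2)
                      (0\<^sub>m n2 (n1 - 1)) S2"

end

theory Submission
  imports Defs "Jordan_Normal_Form.Matrix_Kernel"
begin

text \<open>
  The cost matrix of the vertex sum is \<open>glue_dual\<close> of the two cost matrices, so the primal objective
  at \<open>Z\<close> is the sum of the objectives at the two overlapping principal submatrices of \<open>Z\<close>, which are
  feasible for the parts. For \<open>glue_primal\<close> these submatrices are \<open>X1\<close> and \<open>X2\<close>, hence
  optimality. Feasibility and rank come from the block \<open>LDL\<^sup>T\<close> factorization: \<open>glue_primal\<close> is
  congruent to \<open>X1 \<oplus> B\<close> and \<open>X2\<close> is congruent to \<open>1 \<oplus> B\<close>, where \<open>B = Y2 - y2 y2\<^sup>T\<close>.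

  Strong duality is avoided for the dual problem. Any dual feasible matrix of the vertex sum is
  \<open>glue_dual\<close> of two matrices of the form diagonal minus cost, not necessarily positive semidefinite.
  Shifting a suitable amount of the shared diagonal entry from one to the other makes both of them
  positive semidefinite without changing the objective, so the dual value of the vertex sum is at
  least the sum of the dual values of the parts.
\<close>

section \<open>Rank and positive semidefiniteness of block matrices\<close>

text \<open>Rank-nullity for multiplication by \<open>A\<close>, whose image is the column space.
  Ranks are computed through kernels below, since kernel dimensions behave well under invertible
  factors and block diagonal sums.\<close>

lemma rank_plus_kernel_dim:
  fixes A :: "'a :: field mat"
  assumes A: "A \<in> carrier_mat nr nc"
  shows "vec_space.rank nr A + kernel.dim nc A = nc"
proof -
  interpret K: kernel nr nc A by unfold_locales (rule A)
  interpret W: vec_space "TYPE('a)" nr .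
  interpret T: linear_map class_ring "module_vec TYPE('a) nc" "module_vec TYPE('a) nr" "\<lambda>v. A *\<^sub>v v"
  proof (unfold_locales)
    show "(*\<^sub>v) A \<in> LinearCombinations.module_hom class_ring
        (module_vec TYPE('a) nc) (module_vec TYPE('a) nr)"
      using A by (auto simp: LinearCombinations.module_hom_def module_vec_simps
          mult_add_distrib_mat_vec[OF A] mult_mat_vec[OF A])
  qed
  have "T.imT = W.span (set (cols A))"
    using W.col_space_eq[OF A] A unfolding W.col_space_def T.im_def by auto
  moreover have "T.kerT = mat_kernel A"
    unfolding T.ker_def mat_kernel[OF A] by auto
  ultimately show ?thesis
    using T.rank_nullity K.NC.fin_dim K.NC.dim_is_n unfolding W.rank_def by simp
qed

text \<open>The left factor leaves the kernel itself unchanged; the right factor moves it to an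
  isomorphic space.\<close>

lemma kernel_dim_equivalent:
  fixes A :: "'a :: field mat"
  assumes A: "A \<in> carrier_mat n n" and P: "P \<in> carrier_mat n n" "P' \<in> carrier_mat n n" "P' * P = 1\<^sub>m n"
    and Q: "Q \<in> carrier_mat n n" "Q' \<in> carrier_mat n n" "Q * Q' = 1\<^sub>m n"
  shows "kernel.dim n (P * A * Q) = kernel.dim n A"
proof -
  have "kernel.dim n (P * A * Q) = kernel.dim n (P * A)"
    using mat_kernel_dim_mult_eq_right[of "P * A" n n Q Q'] A P Q by auto
  also have "mat_kernel (P * A) = mat_kernel A"
    by (rule mat_kernel_mult_eq[OF A P(1,2,3)])
  finally show ?thesis using A P by simp
qed

section \<open>Block elimination by unit triangular congruence\<close>

definition unitriangular :: "'a :: comm_ring_1 mat \<Rightarrow> 'a mat" where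
  "unitriangular V = four_block_mat (1\<^sub>m (dim_row V)) V (0\<^sub>m (dim_col V) (dim_row V)) (1\<^sub>m (dim_col V))"

lemma unitriangular_carrier:
  "V \<in> carrier_mat n p \<Longrightarrow> unitriangular V \<in> carrier_mat (n + p) (n + p)"
  unfolding unitriangular_def by auto

text \<open>Such matrices multiply by adding their corner blocks, so \<open>V\<close> and
  \<open>- V\<close> cancel in either order.\<close>

lemma unitriangular_inverse:
  assumes V: "V \<in> carrier_mat n p"
  shows "unitriangular V * unitriangular (- V) = 1\<^sub>m (n + p)"
    and "unitriangular (- V) * unitriangular V = 1\<^sub>m (n + p)"
proof -
  have *: "unitriangular V * unitriangular W = 1\<^sub>m (n + p)"
    if "V \<in> carrier_mat n p" "W \<in> carrier_mat n p" "W + V = 0\<^sub>m n p" for V W :: "'a mat"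
  proof -
    have "unitriangular V * unitriangular W =
        four_block_mat (1\<^sub>m n * 1\<^sub>m n + V * 0\<^sub>m p n) (1\<^sub>m n * W + V * 1\<^sub>m p)
          (0\<^sub>m p n * 1\<^sub>m n + 1\<^sub>m p * 0\<^sub>m p n) (0\<^sub>m p n * W + 1\<^sub>m p * 1\<^sub>m p)"
      using that unfolding unitriangular_def by (subst mult_four_block_mat[of _ n n _ p _ p _ _ n _ p]) auto
    also have "\<dots> = four_block_mat (1\<^sub>m n) (0\<^sub>m n p) (0\<^sub>m p n) (1\<^sub>m p)"
      using that by (intro cong_four_block_mat) auto
    finally show ?thesis by simp
  qed
  show "unitriangular V * unitriangular (- V) = 1\<^sub>m (n + p)"
    and "unitriangular (- V) * unitriangular V = 1\<^sub>m (n + p)"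
    using V by (intro *; auto)+
qed

definition block_diag :: "'a :: zero mat \<Rightarrow> 'a mat \<Rightarrow> 'a mat" where
  "block_diag A B = four_block_mat A (0\<^sub>m (dim_row A) (dim_col B)) (0\<^sub>m (dim_row B) (dim_col A)) B"

lemma block_diag_carrier:
  "A \<in> carrier_mat n n \<Longrightarrow> B \<in> carrier_mat p p \<Longrightarrow> block_diag A B \<in> carrier_mat (n + p) (n + p)"
  unfolding block_diag_def by auto

text \<open>Block elimination read backwards, with \<open>B\<close> as a generalized Schur
  complement of \<open>X\<close>. The corner block is given as \<open>X * V\<close> and no inverse
  of \<open>X\<close> occurs, so \<open>X\<close> may be singular, as optimal primal solutions can
  be.\<close>

lemma block_congruence:
  fixes X B :: "'a :: comm_ring_1 mat"
  assumes X: "X \<in> carrier_mat n n" and V: "V \<in> carrier_mat n p" and B: "B \<in> carrier_mat p p"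
  shows "transpose_mat (unitriangular V) * block_diag X B * unitriangular V =
    four_block_mat X (X * V) (transpose_mat V * X) (transpose_mat V * X * V + B)"
proof -
  have "transpose_mat (unitriangular V) = four_block_mat (1\<^sub>m n) (0\<^sub>m n p) (transpose_mat V) (1\<^sub>m p)"
    using V unfolding unitriangular_def by (subst transpose_four_block_mat) auto
  moreover have "four_block_mat (1\<^sub>m n) (0\<^sub>m n p) (transpose_mat V) (1\<^sub>m p) * block_diag X B
      = four_block_mat X (0\<^sub>m n p) (transpose_mat V * X) B"
    using X V B unfolding block_diag_def
    by (subst mult_four_block_mat[of _ n n _ p _ p _ _ n _ p]) (auto intro!: cong_four_block_mat)
  moreover have "four_block_mat X (0\<^sub>m n p) (transpose_mat V * X) B * unitriangular V
     = four_block_mat X (X * V) (transpose_mat V * X) (transpose_mat V * X * V + B)"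
    using X V B unfolding unitriangular_def
    by (subst mult_four_block_mat[of _ n n _ p _ p _ _ n _ p]) (auto intro!: cong_four_block_mat)
  ultimately show ?thesis by simp
qed

text \<open>Congruence by \<open>unitriangular V\<close> reduces the matrix to
  \<open>block_diag X B\<close>, whose kernel dimension is the sum of those of the blocks;
  rank-nullity turns this into a sum of ranks.\<close>

lemma rank_block:
  fixes X B :: "'a :: field mat"
  assumes X: "X \<in> carrier_mat n n" and V: "V \<in> carrier_mat n p" and B: "B \<in> carrier_mat p p"
  shows "vec_space.rank (n + p)
      (four_block_mat X (X * V) (transpose_mat V * X) (transpose_mat V * X * V + B))
    = vec_space.rank n X + vec_space.rank p B"
proof -
  let ?U = "unitriangular V" and ?W = "unitriangular (- V)" and ?D = "block_diag X B"
  let ?F = "four_block_mat X (X * V) (transpose_mat V * X) (transpose_mat V * X * V + B)"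
  have U: "?U \<in> carrier_mat (n + p) (n + p)" and W: "?W \<in> carrier_mat (n + p) (n + p)"
    using V by (auto intro: unitriangular_carrier)
  have D: "?D \<in> carrier_mat (n + p) (n + p)" using X B by (rule block_diag_carrier)
  have F: "?F \<in> carrier_mat (n + p) (n + p)" using X B V by auto
  have "transpose_mat ?W * transpose_mat ?U = 1\<^sub>m (n + p)"
    using transpose_mult[OF U W] unitriangular_inverse[OF V] by simp
  then have "kernel.dim (n + p) (transpose_mat ?U * ?D * ?U) = kernel.dim (n + p) ?D"
    using U W D unitriangular_inverse[OF V] by (intro kernel_dim_equivalent[of _ _ _ "transpose_mat ?W" _ ?W]) auto
  then have "kernel.dim (n + p) ?F = kernel.dim n X + kernel.dim p B"
    unfolding block_congruence[OF X V B]
    using kernel_four_block_0_mat[of ?D X n p B] X B by (auto simp: block_diag_def)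
  then show ?thesis
    using rank_plus_kernel_dim[OF F] rank_plus_kernel_dim[OF X] rank_plus_kernel_dim[OF B] by linarith
qed

section \<open>Positive semidefiniteness under congruence and direct sums\<close>

lemma quadratic_form_congruence:
  fixes A P :: "'a :: comm_ring_1 mat"
  assumes A: "A \<in> carrier_mat n n" and P: "P \<in> carrier_mat n k" and x: "x \<in> carrier_vec k"
  shows "x \<bullet> (transpose_mat P * A * P *\<^sub>v x) = (P *\<^sub>v x) \<bullet> (A *\<^sub>v (P *\<^sub>v x))"
proof -
  have "transpose_mat P * A * P *\<^sub>v x = (transpose_mat P * A) *\<^sub>v (P *\<^sub>v x)"
    using A P x by (intro assoc_mult_mat_vec[of _ k n]) auto
  also have "\<dots> = transpose_mat P *\<^sub>v (A *\<^sub>v (P *\<^sub>v x))"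
    using A P x by (intro assoc_mult_mat_vec[of _ k n]) auto
  finally show ?thesis
    using transpose_vec_mult_scalar[OF P x, of "A *\<^sub>v (P *\<^sub>v x)"] A P x
      comm_scalar_prod[of x k "transpose_mat P *\<^sub>v (A *\<^sub>v (P *\<^sub>v x))"]
      comm_scalar_prod[of "P *\<^sub>v x" n "A *\<^sub>v (P *\<^sub>v x)"] by simp
qed

lemma psd_mat_congruence:
  assumes "psd_mat n A" and P: "P \<in> carrier_mat n k"
  shows "psd_mat k (transpose_mat P * A * P)"
proof -
  have A: "A \<in> carrier_mat n n" "transpose_mat A = A" using assms by (auto simp: psd_mat_def)
  have "transpose_mat (transpose_mat P * A * P) = transpose_mat P * A * P"
    using A P transpose_mult[of "transpose_mat P * A" k n P k] transpose_mult[of "transpose_mat P" k n A n]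
      assoc_mult_mat[of "transpose_mat P" k n A n P k] by simp
  then show ?thesis
    using assms A P quadratic_form_congruence[OF A(1) P] unfolding psd_mat_def by auto
qed

text \<open>The quadratic form of a direct sum is the sum of the two forms. Vectors padded with
  zeros recover each block; conversely, a vector is cut into its first \<open>n\<close> and last
  \<open>p\<close> entries.\<close>

lemma psd_mat_block_diag:
  assumes X: "X \<in> carrier_mat n n" and B: "B \<in> carrier_mat p p"
  shows "psd_mat (n + p) (block_diag X B) \<longleftrightarrow> psd_mat n X \<and> psd_mat p B"
proof -
  have q: "(x @\<^sub>v y) \<bullet> (block_diag X B *\<^sub>v (x @\<^sub>v y)) = x \<bullet> (X *\<^sub>v x) + y \<bullet> (B *\<^sub>v y)"
    if x: "x \<in> carrier_vec n" and y: "y \<in> carrier_vec p" for x y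
  proof -
    have "block_diag X B *\<^sub>v (x @\<^sub>v y) = (X *\<^sub>v x + 0\<^sub>m n p *\<^sub>v y) @\<^sub>v (0\<^sub>m p n *\<^sub>v x + B *\<^sub>v y)"
      using X B x y unfolding block_diag_def by (subst four_block_mat_mult_vec[of _ n n _ p _ p]) auto
    also have "\<dots> = (X *\<^sub>v x) @\<^sub>v (B *\<^sub>v y)"
      using X B x y by (intro arg_cong2[where f = append_vec] eq_vecI) auto
    finally show ?thesis
      using X B x y by (simp add: scalar_prod_append[of _ n _ p])
  qed
  have D: "block_diag X B \<in> carrier_mat (n + p) (n + p)" using X B by (rule block_diag_carrier)
  have transpose: "transpose_mat (block_diag X B) = block_diag (transpose_mat X) (transpose_mat B)"
    using X B unfolding block_diag_def by (subst transpose_four_block_mat[of _ n n _ p _ p]) auto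
  show ?thesis
  proof (intro iffI conjI)
    assume psd: "psd_mat (n + p) (block_diag X B)"
    then have sym: "block_diag (transpose_mat X) (transpose_mat B) = block_diag X B"
      and nonneg: "\<And>v. v \<in> carrier_vec (n + p) \<Longrightarrow> 0 \<le> v \<bullet> (block_diag X B *\<^sub>v v)"
      by (simp_all add: psd_mat_def transpose)
    have "transpose_mat X $$ (i, j) = X $$ (i, j)" if "i < n" "j < n" for i j
      using arg_cong[OF sym, of "\<lambda>M. M $$ (i, j)"] that X B by (simp add: block_diag_def)
    then have "transpose_mat X = X" using X by (intro eq_matI) auto
    moreover have "0 \<le> x \<bullet> (X *\<^sub>v x)" if "x \<in> carrier_vec n" for x
      using nonneg[of "x @\<^sub>v 0\<^sub>v p"] q[OF that zero_carrier_vec] that B by simp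
    ultimately show "psd_mat n X" using X by (simp add: psd_mat_def)
    have "transpose_mat B $$ (i, j) = B $$ (i, j)" if "i < p" "j < p" for i j
      using arg_cong[OF sym, of "\<lambda>M. M $$ (n + i, n + j)"] that X B by (simp add: block_diag_def)
    then have "transpose_mat B = B" using B by (intro eq_matI) auto
    moreover have "0 \<le> x \<bullet> (B *\<^sub>v x)" if "x \<in> carrier_vec p" for x
      using nonneg[of "0\<^sub>v n @\<^sub>v x"] q[OF zero_carrier_vec that] that X by simp
    ultimately show "psd_mat p B" using B by (simp add: psd_mat_def)
  next
    assume "psd_mat n X \<and> psd_mat p B"
    then have sym: "transpose_mat X = X" "transpose_mat B = B"
      and nonneg: "\<And>x. x \<in> carrier_vec n \<Longrightarrow> 0 \<le> x \<bullet> (X *\<^sub>v x)"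
        "\<And>y. y \<in> carrier_vec p \<Longrightarrow> 0 \<le> y \<bullet> (B *\<^sub>v y)"
      by (auto simp: psd_mat_def)
    have "0 \<le> v \<bullet> (block_diag X B *\<^sub>v v)" if "v \<in> carrier_vec (n + p)" for v
      using q[of "vec_first v n" "vec_last v p"] nonneg(1)[of "vec_first v n"] nonneg(2)[of "vec_last v p"]
      by (simp add: vec_first_last_append[OF that])
    then show "psd_mat (n + p) (block_diag X B)"
      using D sym by (simp add: psd_mat_def transpose)
  qed
qed

text \<open>Congruence by \<open>unitriangular V\<close> is undone by congruence with
  \<open>unitriangular (- V)\<close>, so semidefiniteness passes both ways. One direction extracts
  the remainder block of \<open>X2\<close>, the other assembles \<open>glue_primal\<close>.\<close>

lemma psd_mat_block:
  assumes X: "X \<in> carrier_mat n n" and V: "V \<in> carrier_mat n p" and B: "B \<in> carrier_mat p p"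
  shows "psd_mat (n + p)
      (four_block_mat X (X * V) (transpose_mat V * X) (transpose_mat V * X * V + B))
    \<longleftrightarrow> psd_mat n X \<and> psd_mat p B"
proof -
  let ?U = "unitriangular V" and ?W = "unitriangular (- V)" and ?D = "block_diag X B"
  have U: "?U \<in> carrier_mat (n + p) (n + p)" and W: "?W \<in> carrier_mat (n + p) (n + p)"
    using V by (auto intro: unitriangular_carrier)
  have D: "?D \<in> carrier_mat (n + p) (n + p)" using X B by (rule block_diag_carrier)
  have UW: "transpose_mat ?W * transpose_mat ?U = 1\<^sub>m (n + p)"
    using transpose_mult[OF U W] unitriangular_inverse[OF V] by simp
  have "transpose_mat ?W * (transpose_mat ?U * ?D * ?U) * ?W
      = (transpose_mat ?W * transpose_mat ?U) * ?D * (?U * ?W)"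
    using U W D by (simp add: assoc_mult_mat[of _ "n+p" "n+p" _ "n+p" _ "n+p"])
  also have "\<dots> = ?D"
    using UW D unitriangular_inverse[OF V] by simp
  finally have "psd_mat (n + p) (transpose_mat ?U * ?D * ?U) \<longleftrightarrow> psd_mat (n + p) ?D"
    using psd_mat_congruence[OF _ U] psd_mat_congruence[OF _ W] by metis
  then show ?thesis unfolding block_congruence[OF assms] psd_mat_block_diag[OF X B] .
qed

section \<open>Overlapping principal submatrices\<close>

text \<open>Reduces sums over the large index range to sums over one part of a vertex sum; the
  offset is 0 for the first part and the shared index for the second.\<close>

lemma sum_shifted_window:
  fixes f :: "nat \<Rightarrow> 'a :: comm_monoid_add"
  assumes "m + k \<le> n"
  shows "(\<Sum>i<n. if m \<le> i \<and> i < m + k then f (i - m) else 0) = (\<Sum>i<k. f i)"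
proof -
  have "(\<Sum>i<n. if m \<le> i \<and> i < m + k then f (i - m) else 0) = (\<Sum>i\<in>{m..<m + k}. f (i - m))"
    using assms by (intro sum.mono_neutral_cong_right) auto
  also have "\<dots> = (\<Sum>i<k. f i)"
    by (rule sum.reindex_bij_witness[of _ "\<lambda>i. i + m" "\<lambda>i. i - m"]) auto
  finally show ?thesis .
qed

text \<open>Membership in the square window is a row condition and a column condition, so the
  one-dimensional identity applies to the inner and then to the outer sum.\<close>

lemma sum2_shifted_window:
  fixes f :: "nat \<Rightarrow> nat \<Rightarrow> 'a :: comm_monoid_add"
  assumes "m + k \<le> n"
  shows "(\<Sum>i<n. \<Sum>j<n. if m \<le> i \<and> i < m + k \<and> m \<le> j \<and> j < m + k then f (i - m) (j - m) else 0)
    = (\<Sum>i<k. \<Sum>j<k. f i j)"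
proof -
  have "(\<Sum>i<n. \<Sum>j<n. if m \<le> i \<and> i < m + k \<and> m \<le> j \<and> j < m + k then f (i - m) (j - m) else 0)
      = (\<Sum>i<n. if m \<le> i \<and> i < m + k then
          (\<Sum>j<n. if m \<le> j \<and> j < m + k then f (i - m) (j - m) else 0) else 0)"
    by (intro sum.cong) (auto intro!: sum.neutral)
  also have "\<dots> = (\<Sum>i<k. \<Sum>j<k. f i j)"
    unfolding sum_shifted_window[OF assms]
    by (rule sum_shifted_window[OF assms, of "\<lambda>i. \<Sum>j<k. f i j"])
  finally show ?thesis .
qed

section \<open>Quadratic forms and principal submatrices\<close>

definition quad_form :: "nat \<Rightarrow> real mat \<Rightarrow> (nat \<Rightarrow> real) \<Rightarrow> real" where
  "quad_form n A f = (\<Sum>i<n. \<Sum>j<n. A $$ (i, j) * (f i * f j))"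

text \<open>Test vectors become functions on all naturals, so that restricting or shifting them
  needs no dimension bookkeeping. Values at indices from \<open>n\<close> on do not enter the
  form.\<close>

lemma psd_mat_iff_quad_form:
  "psd_mat n A \<longleftrightarrow> A \<in> carrier_mat n n \<and> transpose_mat A = A \<and> (\<forall>f. 0 \<le> quad_form n A f)"
proof -
  have q: "x \<bullet> (A *\<^sub>v x) = quad_form n A (($) x)"
    if "A \<in> carrier_mat n n" "x \<in> carrier_vec n" for x
    using that by (auto simp: quad_form_def scalar_prod_def sum_distrib_left lessThan_atLeast0 mult_ac
        intro!: sum.cong)
  have "quad_form n A (($) (vec n f)) = quad_form n A f" for f
    by (simp add: quad_form_def)
  then have "(\<forall>x\<in>carrier_vec n. 0 \<le> quad_form n A (($) x)) \<longleftrightarrow> (\<forall>f. 0 \<le> quad_form n A f)"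
    by (metis vec_carrier)
  with q show ?thesis unfolding psd_mat_def by auto
qed

lemma quad_form_homogeneous: "quad_form n A (\<lambda>i. c * f i) = c\<^sup>2 * quad_form n A f"
  by (simp add: quad_form_def sum_distrib_left power2_eq_square mult_ac)

definition shifted_submatrix :: "nat \<Rightarrow> nat \<Rightarrow> 'a mat \<Rightarrow> 'a mat" where
  "shifted_submatrix m k Z = mat k k (\<lambda>(i, j). Z $$ (i + m, j + m))"

text \<open>Extending a test function by zero outside the index window turns the form of the
  submatrix into the form of \<open>Z\<close>.\<close>

lemma psd_mat_shifted_submatrix:
  assumes Z: "psd_mat n Z" and le: "m + k \<le> n"
  shows "psd_mat k (shifted_submatrix m k Z)"
proof -
  have Zc: "Z \<in> carrier_mat n n" and Zt: "transpose_mat Z = Z" using Z by (auto simp: psd_mat_def)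
  have "quad_form k (shifted_submatrix m k Z) f
      = quad_form n Z (\<lambda>i. if m \<le> i \<and> i < m + k then f (i - m) else 0)" for f
  proof -
    have "quad_form k (shifted_submatrix m k Z) f = (\<Sum>i<k. \<Sum>j<k. Z $$ (i + m, j + m) * (f i * f j))"
      by (simp add: quad_form_def shifted_submatrix_def)
    also have "\<dots> = quad_form n Z (\<lambda>i. if m \<le> i \<and> i < m + k then f (i - m) else 0)"
      unfolding sum2_shifted_window[OF le, symmetric] quad_form_def by (intro sum.cong) auto
    finally show ?thesis .
  qed
  moreover have "Z $$ (j, i) = Z $$ (i, j)" if "i < n" "j < n" for i j
    using arg_cong[OF Zt, of "\<lambda>M. M $$ (i, j)"] that Zc by simp
  then have "transpose_mat (shifted_submatrix m k Z) = shifted_submatrix m k Z"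
    using le by (intro eq_matI) (auto simp: shifted_submatrix_def)
  ultimately show ?thesis
    using Z by (simp add: psd_mat_iff_quad_form shifted_submatrix_def)
qed

lemma primal_feasible_shifted_submatrix:
  "primal_feasible n Z \<Longrightarrow> m + k \<le> n \<Longrightarrow> primal_feasible k (shifted_submatrix m k Z)"
  using psd_mat_shifted_submatrix by (auto simp: primal_feasible_def shifted_submatrix_def)

section \<open>Matrices overlapping in one diagonal entry\<close>

context
  fixes m p :: nat and A B :: "real mat"
  assumes A: "A \<in> carrier_mat (Suc m) (Suc m)" and B: "B \<in> carrier_mat (Suc p) (Suc p)"
begin

lemma glue_dual_carrier: "glue_dual (Suc m) (Suc p) A B \<in> carrier_mat (m + Suc p) (m + Suc p)"
  using A B by (auto simp: glue_dual_def)

text \<open>Writing the sizes as \<open>Suc m\<close> and \<open>Suc p\<close> makes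
  \<open>m\<close> the shared index and avoids truncated sizes. Only at \<open>(m, m)\<close> do
  both summands contribute.\<close>

lemma index_glue_dual:
  assumes "i < m + Suc p" "j < m + Suc p"
  shows "glue_dual (Suc m) (Suc p) A B $$ (i, j) =
    (if i < Suc m \<and> j < Suc m then A $$ (i, j) else 0)
    + (if m \<le> i \<and> m \<le> j then B $$ (i - m, j - m) else 0)"
  using A B assms by (auto simp: glue_dual_def)

text \<open>The factor \<open>h\<close> is arbitrary in order to cover two cases:
  \<open>h i j = f i * f j\<close> gives quadratic forms, and \<open>h i j = Z $$ (j, i)\<close>
  gives traces of products with \<open>Z\<close>.\<close>

lemma sum_glue_dual:
  "(\<Sum>i<m + Suc p. \<Sum>j<m + Suc p. glue_dual (Suc m) (Suc p) A B $$ (i, j) * h i j)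
  = (\<Sum>i<Suc m. \<Sum>j<Suc m. A $$ (i, j) * h i j)
    + (\<Sum>i<Suc p. \<Sum>j<Suc p. B $$ (i, j) * h (i + m) (j + m))"
proof -
  \<comment> \<open>The offset 0 is written out to put the first summand into the same window form
    as the second.\<close>
  have "(\<Sum>i<m + Suc p. \<Sum>j<m + Suc p. glue_dual (Suc m) (Suc p) A B $$ (i, j) * h i j)
    = (\<Sum>i<m + Suc p. \<Sum>j<m + Suc p.
        if 0 \<le> i \<and> i < 0 + Suc m \<and> 0 \<le> j \<and> j < 0 + Suc m then
        A $$ (i - 0, j - 0) * h (i - 0) (j - 0) else 0)
      + (\<Sum>i<m + Suc p. \<Sum>j<m + Suc p.
        if m \<le> i \<and> i < m + Suc p \<and> m \<le> j \<and> j < m + Suc p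
        then B $$ (i - m, j - m) * h (i - m + m) (j - m + m) else 0)"
    unfolding sum.distrib[symmetric] by (intro sum.cong) (auto simp: index_glue_dual algebra_simps)
  also have "\<dots> = (\<Sum>i<Suc m. \<Sum>j<Suc m. A $$ (i, j) * h i j)
    + (\<Sum>i<Suc p. \<Sum>j<Suc p. B $$ (i, j) * h (i + m) (j + m))"
    by (intro arg_cong2[where f = "(+)"] sum2_shifted_window) auto
  finally show ?thesis .
qed

lemma quad_form_glue_dual:
  "quad_form (m + Suc p) (glue_dual (Suc m) (Suc p) A B) f
  = quad_form (Suc m) A f + quad_form (Suc p) B (\<lambda>i. f (i + m))"
  unfolding quad_form_def by (rule sum_glue_dual)

lemma transpose_glue_dual:
  "transpose_mat (glue_dual (Suc m) (Suc p) A B)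
    = glue_dual (Suc m) (Suc p) (transpose_mat A) (transpose_mat B)"
  using A B by (intro eq_matI) (auto simp: glue_dual_def)

text \<open>The trace of a product is an entrywise pairing, and \<open>glue_dual\<close> vanishes
  outside its two blocks; hence only the two overlapping principal submatrices of \<open>Z\<close>
  are seen.\<close>

lemma mat_trace_glue_dual:
  assumes Z: "Z \<in> carrier_mat (m + Suc p) (m + Suc p)"
  shows "mat_trace (glue_dual (Suc m) (Suc p) A B * Z)
    = mat_trace (A * shifted_submatrix 0 (Suc m) Z) + mat_trace (B * shifted_submatrix m (Suc p) Z)"
proof -
  have tr: "mat_trace (M * N) = (\<Sum>i<k. \<Sum>j<k. M $$ (i, j) * N $$ (j, i))"
    if "M \<in> carrier_mat k k" "N \<in> carrier_mat k k" for M N :: "real mat" and k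
    using that by (auto simp: mat_trace_def scalar_prod_def lessThan_atLeast0 intro!: sum.cong)
  have "mat_trace (A * shifted_submatrix 0 (Suc m) Z) = (\<Sum>i<Suc m. \<Sum>j<Suc m. A $$ (i, j) * Z $$ (j, i))"
    using A by (subst tr[of _ "Suc m"]) (auto simp: shifted_submatrix_def intro!: sum.cong)
  moreover have "mat_trace (B * shifted_submatrix m (Suc p) Z)
      = (\<Sum>i<Suc p. \<Sum>j<Suc p. B $$ (i, j) * Z $$ (j + m, i + m))"
    using B by (subst tr[of _ "Suc p"]) (auto simp: shifted_submatrix_def intro!: sum.cong)
  ultimately show ?thesis
    using sum_glue_dual[of "\<lambda>i j. Z $$ (j, i)"] tr[OF glue_dual_carrier Z] by simp
qed

end

section \<open>Semidefiniteness of overlapping sums\<close>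

lemma psd_mat_glue_dual:
  assumes "psd_mat (Suc m) A" "psd_mat (Suc p) B"
  shows "psd_mat (m + Suc p) (glue_dual (Suc m) (Suc p) A B)"
proof -
  have A: "A \<in> carrier_mat (Suc m) (Suc m)" and B: "B \<in> carrier_mat (Suc p) (Suc p)"
    using assms by (auto simp: psd_mat_def)
  show ?thesis
    using assms glue_dual_carrier[OF A B] transpose_glue_dual[OF A B] quad_form_glue_dual[OF A B]
    by (simp add: psd_mat_iff_quad_form)
qed

text \<open>Normalize both arguments to the value 1 at the marked indices. Then
  \<open>- q2 g\<close> is at most \<open>q1 f\<close> for all such \<open>f\<close> and
  \<open>g\<close>, so the infimum of \<open>q1\<close> separates the two and serves as
  \<open>c\<close>; homogeneity removes the normalization.\<close>

lemma homogeneous_split: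
  fixes q1 q2 :: "(nat \<Rightarrow> real) \<Rightarrow> real"
  assumes hom1: "\<And>c f. q1 (\<lambda>i. c * f i) = c\<^sup>2 * q1 f"
    and hom2: "\<And>c f. q2 (\<lambda>i. c * f i) = c\<^sup>2 * q2 f"
    and nonneg: "\<And>f g. f s = g t \<Longrightarrow> 0 \<le> q1 f + q2 g"
  obtains c where "\<And>f. c * (f s)\<^sup>2 \<le> q1 f" "\<And>g. - c * (g t)\<^sup>2 \<le> q2 g"
proof
  let ?Q = "q1 ` {f. f s = 1}"
  define c where "c = Inf ?Q"
  have ne: "?Q \<noteq> {}" by (auto intro: exI[of _ "\<lambda>_. 1"])
  have lower: "- q2 g \<le> x" if "g t = 1" "x \<in> ?Q" for g x
  proof -
    from that obtain f where "f s = 1" "x = q1 f" by auto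
    then show ?thesis using nonneg[of f g] that by simp
  qed
  \<comment> \<open>The constant function 1 is normalized at \<open>t\<close>, so it supplies a
    lower bound.\<close>
  have bdd: "bdd_below ?Q" using lower[of "\<lambda>_. 1"] by (intro bdd_belowI) auto
  have c1: "c \<le> q1 f" if "f s = 1" for f
    unfolding c_def using that bdd by (intro cInf_lower) auto
  have c2: "- q2 g \<le> c" if "g t = 1" for g
    unfolding c_def using that ne lower by (intro cInf_greatest) auto
  have zero: "q1 (\<lambda>_. 0) = 0" "q2 (\<lambda>_. 0) = 0"
    using hom1[of 0 "\<lambda>_. 0"] hom2[of 0 "\<lambda>_. 0"] by simp_all
  \<comment> \<open>A function vanishing at the marked index cannot be rescaled; it is paired with
    the zero function, at which the other form is 0.\<close>
  show "c * (f s)\<^sup>2 \<le> q1 f" for f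
  proof (cases "f s = 0")
    case True
    then show ?thesis using nonneg[of f "\<lambda>_. 0"] zero by simp
  next
    case False
    then show ?thesis
      using c1[of "\<lambda>i. f i / f s"] hom1[of "f s" "\<lambda>i. f i / f s"]
        mult_right_mono[of c "q1 (\<lambda>i. f i / f s)" "(f s)\<^sup>2"]
      by (simp add: mult.commute)
  qed
  show "- c * (g t)\<^sup>2 \<le> q2 g" for g
  proof (cases "g t = 0")
    case True
    then show ?thesis using nonneg[of "\<lambda>_. 0" g] zero by simp
  next
    case False
    then show ?thesis
      using c2[of "\<lambda>i. g i / g t"] hom2[of "g t" "\<lambda>i. g i / g t"]
        mult_right_mono[of "- c" "q2 (\<lambda>i. g i / g t)" "(g t)\<^sup>2"]
      by (simp add: mult.commute)
  qed
qed

lemma quad_form_point_mass: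
  assumes "A \<in> carrier_mat n n" "s < n"
  shows "quad_form n (A + mat_diag n (\<lambda>i. if i = s then c else 0)) f = quad_form n A f + c * (f s)\<^sup>2"
proof -
  have "quad_form n (A + mat_diag n (\<lambda>i. if i = s then c else 0)) f
     = (\<Sum>i<n. \<Sum>j<n. A $$ (i, j) * (f i * f j) + (if i = s then if j = s then c * (f s * f s) else 0 else 0))"
    unfolding quad_form_def using assms by (intro sum.cong) (auto simp: mat_diag_def algebra_simps)
  also have "\<dots> = quad_form n A f + (\<Sum>i<n. if i = s then c * (f s * f s) else 0)"
    unfolding sum.distrib quad_form_def using assms by (intro arg_cong2[where f = "(+)"] sum.cong) auto
  also have "\<dots> = quad_form n A f + c * (f s)\<^sup>2"
    using assms by (simp add: power2_eq_square)
  finally show ?thesis .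
qed

text \<open>Semidefiniteness of the overlapping sum makes the two forms add up to a nonnegative
  number whenever their arguments agree at the shared index. \<open>homogeneous_split\<close> then
  yields the multiple of the squared shared coordinate to move from one form to the other;
  \<open>- c\<close> and \<open>c\<close> cancel in the overlap.\<close>

lemma psd_mat_glue_dual_split:
  assumes A: "A \<in> carrier_mat (Suc m) (Suc m)" "transpose_mat A = A"
    and B: "B \<in> carrier_mat (Suc p) (Suc p)" "transpose_mat B = B"
    and psd: "psd_mat (m + Suc p) (glue_dual (Suc m) (Suc p) A B)"
  obtains c where "psd_mat (Suc m) (A + mat_diag (Suc m) (\<lambda>i. if i = m then - c else 0))"
    and "psd_mat (Suc p) (B + mat_diag (Suc p) (\<lambda>i. if i = 0 then c else 0))"
proof -
  have nonneg: "0 \<le> quad_form (Suc m) A f + quad_form (Suc p) B g" if "f m = g 0" for f g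
  proof -
    \<comment> \<open>At the shared index the pasted function takes the value \<open>f m\<close>,
      which equals \<open>g 0\<close>, so its shift by \<open>m\<close> is exactly
      \<open>g\<close>.\<close>
    let ?h = "\<lambda>i. if i \<le> m then f i else g (i - m)"
    have "quad_form (Suc m) A ?h = quad_form (Suc m) A f"
      unfolding quad_form_def by (intro sum.cong) auto
    moreover have "(\<lambda>i. ?h (i + m)) = g" using that by auto
    moreover have "0 \<le> quad_form (m + Suc p) (glue_dual (Suc m) (Suc p) A B) ?h"
      using psd unfolding psd_mat_iff_quad_form by blast
    ultimately show ?thesis
      unfolding quad_form_glue_dual[OF A(1) B(1)] by simp
  qed
  have diag: "transpose_mat (M + mat_diag n (\<lambda>i. if i = s then d else 0))
      = M + mat_diag n (\<lambda>i. if i = s then d else 0)"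
    if "M \<in> carrier_mat n n" "transpose_mat M = M" for M :: "real mat" and n s d
  proof -
    have "transpose_mat (mat_diag n (\<lambda>i. if i = s then d else 0)) = mat_diag n (\<lambda>i. if i = s then d else 0)"
      by (intro eq_matI) (auto simp: mat_diag_def)
    then show ?thesis using that by (subst transpose_add[of _ n n]) (auto simp: mat_diag_def)
  qed
  obtain c where c: "\<And>f. c * (f m)\<^sup>2 \<le> quad_form (Suc m) A f"
    "\<And>g. - c * (g 0)\<^sup>2 \<le> quad_form (Suc p) B g"
    using homogeneous_split[of "quad_form (Suc m) A" "quad_form (Suc p) B" m 0] quad_form_homogeneous nonneg
    by metis
  have "0 \<le> quad_form (Suc m) A f + - c * (f m)\<^sup>2" "0 \<le> quad_form (Suc p) B f + c * (f 0)\<^sup>2" for f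
    using c(1)[of f] c(2)[of f] by simp_all
  then have "psd_mat (Suc m) (A + mat_diag (Suc m) (\<lambda>i. if i = m then - c else 0))"
    and "psd_mat (Suc p) (B + mat_diag (Suc p) (\<lambda>i. if i = 0 then c else 0))"
    using A B diag[OF A] diag[OF B] quad_form_point_mass[OF A(1), of m "- c"] quad_form_point_mass[OF B(1), of 0 c]
    by (simp_all add: psd_mat_iff_quad_form)
  then show ?thesis by (rule that)
qed

section \<open>The cost matrix and the dual problem of a vertex sum\<close>

lemma weighted_graph_arcD:
  assumes "weighted_graph n G w" "(i, j) \<in> parcs G"
  shows "i < n" "j < n" "i \<noteq> j" "(j, i) \<in> parcs G" "w (i, j) = w (j, i)"
proof -
  interpret pair_graph G using assms by (simp add: weighted_graph_def)
  show "i < n" "j < n" "i \<noteq> j" "(j, i) \<in> parcs G" "w (i, j) = w (j, i)"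
    using assms in_arcsD1[OF assms(2)] in_arcsD2[OF assms(2)] pair_no_loops[OF assms(2)] pair_sym_arcs
    by (auto simp: weighted_graph_def symmetric_def sym_def)
qed

lemma maxcut_cost_carrier: "maxcut_cost n G w \<in> carrier_mat n n"
  by (simp add: maxcut_cost_def laplacian_def)

lemma transpose_maxcut_cost:
  assumes "weighted_graph n G w"
  shows "transpose_mat (maxcut_cost n G w) = maxcut_cost n G w"
  using weighted_graph_arcD[OF assms] by (intro eq_matI) (auto simp: maxcut_cost_def laplacian_def)

text \<open>Off the diagonal, every arc comes from exactly one graph. On the diagonal, weighted
  degrees add, and only the shared vertex can have arcs of both graphs.\<close>

lemma laplacian_vertex_sum:
  assumes G1: "weighted_graph (Suc m) G1 w1" and G2: "weighted_graph (Suc p) G2 w2"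
  shows "laplacian (m + Suc p) (vertex_sum (Suc m) G1 G2) (vertex_sum_weight (Suc m) G1 w1 w2)
    = glue_dual (Suc m) (Suc p) (laplacian (Suc m) G1 w1) (laplacian (Suc p) G2 w2)"
    (is "laplacian _ ?G ?w = ?R")
proof -
  note arc1 = weighted_graph_arcD[OF G1] and arc2 = weighted_graph_arcD[OF G2]
  have w1: "?w (i, j) = w1 (i, j)" if "(i, j) \<in> parcs G1" for i j
    using weighted_graph_vertex_sum(2)[OF G1 G2] that by simp
  have w2: "?w (i + m, j + m) = w2 (i, j)" if "(i, j) \<in> parcs G2" for i j
    using weighted_graph_vertex_sum(3)[OF G1 G2] that by simp
  have arcs: "(i, j) \<in> parcs ?G \<longleftrightarrow>
      (i, j) \<in> parcs G1 \<or> m \<le> i \<and> m \<le> j \<and> (i - m, j - m) \<in> parcs G2" for i j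
  proof -
    have "(i, j) \<in> (\<lambda>(i, j). (i + m, j + m)) ` parcs G2"
      if "m \<le> i" "m \<le> j" "(i - m, j - m) \<in> parcs G2"
      using that by (intro rev_image_eqI[of "(i - m, j - m)"]) auto
    then show ?thesis by (auto simp: vertex_sum_def)
  qed
  have fin: "finite {k. (i, k) \<in> parcs G1}" "finite {k. (j, k) \<in> parcs G2}" for i j
    using arc1 arc2 by (auto intro: finite_subset[of _ "{..<Suc m}"] finite_subset[of _ "{..<Suc p}"])
  have diag: "(\<Sum>k\<in>{k. (i, k) \<in> parcs ?G}. ?w (i, k)) =
      (if i < Suc m then \<Sum>k\<in>{k. (i, k) \<in> parcs G1}. w1 (i, k) else 0)
      + (if m \<le> i then \<Sum>k\<in>{k. (i - m, k) \<in> parcs G2}. w2 (i - m, k) else 0)" for i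
  proof -
    \<comment> \<open>For \<open>i < m\<close> the difference \<open>i - m\<close> is truncated to
      0, so the second neighbourhood has to be set to empty explicitly.\<close>
    let ?N1 = "{k. (i, k) \<in> parcs G1}" and ?N2 = "if m \<le> i then {k. (i - m, k) \<in> parcs G2} else {}"
    have "{k. (i, k) \<in> parcs ?G} = ?N1 \<union> (\<lambda>k. k + m) ` ?N2"
      by (auto simp: arcs intro: rev_image_eqI[of "_ - m"])
    \<comment> \<open>A common element would force both it and \<open>i\<close> to equal
      \<open>m\<close>, which gives a loop.\<close>
    moreover have "?N1 \<inter> (\<lambda>k. k + m) ` ?N2 = {}"
      using arc1 arc2 by fastforce
    ultimately have "(\<Sum>k\<in>{k. (i, k) \<in> parcs ?G}. ?w (i, k))
        = (\<Sum>k\<in>?N1. ?w (i, k)) + (\<Sum>k\<in>(\<lambda>k. k + m) ` ?N2. ?w (i, k))"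
      using fin by (simp add: sum.union_disjoint)
    also have "(\<Sum>k\<in>?N1. ?w (i, k)) = (\<Sum>k\<in>?N1. w1 (i, k))"
      by (intro sum.cong) (auto simp: w1)
    also have "\<dots> = (if i < Suc m then \<Sum>k\<in>?N1. w1 (i, k) else 0)"
      using arc1(1)[of i] by (auto intro: sum.neutral)
    also have "(\<Sum>k\<in>(\<lambda>k. k + m) ` ?N2. ?w (i, k)) = (\<Sum>k\<in>?N2. ?w (i, k + m))"
      by (subst sum.reindex) (auto simp: inj_on_def)
    also have "\<dots> = (if m \<le> i then \<Sum>k\<in>{k. (i - m, k) \<in> parcs G2}. w2 (i - m, k) else 0)"
      using w2[of "i - m"] by (auto intro: sum.cong)
    finally show ?thesis .
  qed
  have L: "laplacian (Suc m) G1 w1 \<in> carrier_mat (Suc m) (Suc m)"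
    "laplacian (Suc p) G2 w2 \<in> carrier_mat (Suc p) (Suc p)" by (simp_all add: laplacian_def)
  show ?thesis
  proof (rule eq_matI)
    fix i j assume "i < dim_row ?R" "j < dim_col ?R"
    then have ij: "i < m + Suc p" "j < m + Suc p" using glue_dual_carrier[OF L] by auto
    show "laplacian (m + Suc p) ?G ?w $$ (i, j) = ?R $$ (i, j)"
    proof (cases "i = j")
      case True
      then show ?thesis
        unfolding index_glue_dual[OF L ij] using ij by (auto simp: laplacian_def diag)
    next
      case False
      have "?w (i, j) = w2 (i - m, j - m)" if "m \<le> i" "m \<le> j" "(i - m, j - m) \<in> parcs G2"
        using w2[OF that(3)] that by simp
      then show ?thesis
        unfolding index_glue_dual[OF L ij] using ij False arc1[of i j] arc2[of "i - m" "j - m"]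
        by (auto simp: laplacian_def arcs w1)
    qed
  qed (use glue_dual_carrier[OF L] in \<open>auto simp: laplacian_def\<close>)
qed

lemma maxcut_cost_vertex_sum:
  assumes G1: "weighted_graph (Suc m) G1 w1" and G2: "weighted_graph (Suc p) G2 w2"
  shows "maxcut_cost (m + Suc p) (vertex_sum (Suc m) G1 G2) (vertex_sum_weight (Suc m) G1 w1 w2)
    = glue_dual (Suc m) (Suc p) (maxcut_cost (Suc m) G1 w1) (maxcut_cost (Suc p) G2 w2)"
  unfolding maxcut_cost_def laplacian_vertex_sum[OF assms]
  by (rule eq_matI) (auto simp: glue_dual_def laplacian_def algebra_simps)

section \<open>Dual variables of the vertex sum and dual optimality\<close>

definition glue_fun :: "nat \<Rightarrow> (nat \<Rightarrow> real) \<Rightarrow> (nat \<Rightarrow> real) \<Rightarrow> nat \<Rightarrow> real" where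
  "glue_fun m f g i = (if i < Suc m then f i else 0) + (if m \<le> i then g (i - m) else 0)"

text \<open>Makes the dual objective additive: the shared coordinate of the glued function is the
  sum of the two coordinates that meet there.\<close>

lemma sum_glue_fun: "(\<Sum>i<m + Suc p. glue_fun m f g i) = (\<Sum>i<Suc m. f i) + (\<Sum>i<Suc p. g i)"
proof -
  have "(\<Sum>i<m + Suc p. glue_fun m f g i)
    = (\<Sum>i<m + Suc p. if 0 \<le> i \<and> i < 0 + Suc m then f (i - 0) else 0)
      + (\<Sum>i<m + Suc p. if m \<le> i \<and> i < m + Suc p then g (i - m) else 0)"
    unfolding sum.distrib[symmetric] by (intro sum.cong) (auto simp: glue_fun_def)
  also have "\<dots> = (\<Sum>i<Suc m. f i) + (\<Sum>i<Suc p. g i)"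
    by (intro arg_cong2[where f = "(+)"] sum_shifted_window) auto
  finally show ?thesis .
qed

text \<open>Serves both to build the slack matrix of the vertex sum and to decompose an arbitrary
  one.\<close>

lemma diag_minus_glue_dual:
  assumes A: "A \<in> carrier_mat (Suc m) (Suc m)" and B: "B \<in> carrier_mat (Suc p) (Suc p)"
  shows "mat_diag (m + Suc p) (glue_fun m f g) - glue_dual (Suc m) (Suc p) A B
    = glue_dual (Suc m) (Suc p) (mat_diag (Suc m) f - A) (mat_diag (Suc p) g - B)"
  using A B by (intro eq_matI) (auto simp: glue_dual_def glue_fun_def mat_diag_def)

text \<open>Dual feasibility asks for a diagonal read off a vector, hence the detour through
  \<open>vec\<close>.\<close>

lemma diag_minus_add_diag:
  assumes "C \<in> carrier_mat n n"
  shows "mat_diag n f - C + mat_diag n g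
    = mat_diag n (\<lambda>i. vec n (\<lambda>i. f i + g i) $ i) - (C :: real mat)"
  using assms by (intro eq_matI) (auto simp: mat_diag_def)

lemma mat_diag_cong: "(\<And>i. i < n \<Longrightarrow> f i = g i) \<Longrightarrow> mat_diag n f = mat_diag n g"
  by (intro eq_matI) (auto simp: mat_diag_def)

text \<open>Gluing the dual vectors attains the sum of the two optimal values, and splitting any
  feasible vector shows that no smaller value occurs.\<close>

lemma optimal_dual_solution_vertex_sum:
  assumes G1: "weighted_graph (Suc m) G1 w1" and G2: "weighted_graph (Suc p) G2 w2"
    and S1: "optimal_dual_solution (Suc m) G1 w1 S1" and S2: "optimal_dual_solution (Suc p) G2 w2 S2"
  shows "optimal_dual_solution (m + Suc p)
    (vertex_sum (Suc m) G1 G2) (vertex_sum_weight (Suc m) G1 w1 w2) (glue_dual (Suc m) (Suc p) S1 S2)"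
    (is "optimal_dual_solution ?n ?G ?w ?S")
proof -
  let ?C1 = "maxcut_cost (Suc m) G1 w1" and ?C2 = "maxcut_cost (Suc p) G2 w2"
  note C1 = maxcut_cost_carrier[of "Suc m" G1 w1] and C2 = maxcut_cost_carrier[of "Suc p" G2 w2]
  have sym: "transpose_mat (mat_diag n f - C) = mat_diag n f - C"
    if "C \<in> carrier_mat n n" "transpose_mat C = C" for n f and C :: "real mat"
  proof -
    have "C $$ (j, i) = C $$ (i, j)" if "i < n" "j < n" for i j
      using arg_cong[OF \<open>transpose_mat C = C\<close>, of "\<lambda>M. M $$ (i, j)"] that \<open>C \<in> carrier_mat n n\<close> by simp
    then show ?thesis using that by (intro eq_matI) (auto simp: mat_diag_def)
  qed
  obtain u where u: "dual_feasible (Suc m) G1 w1 u S1"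
    and u_opt: "\<And>z T. dual_feasible (Suc m) G1 w1 z T \<Longrightarrow> (\<Sum>i<Suc m. u $ i) \<le> (\<Sum>i<Suc m. z $ i)"
    using S1 unfolding optimal_dual_solution_def by blast
  obtain v where v: "dual_feasible (Suc p) G2 w2 v S2"
    and v_opt: "\<And>z T. dual_feasible (Suc p) G2 w2 z T \<Longrightarrow> (\<Sum>i<Suc p. v $ i) \<le> (\<Sum>i<Suc p. z $ i)"
    using S2 unfolding optimal_dual_solution_def by blast
  define y where "y = vec ?n (glue_fun m (($) u) (($) v))"
  have "mat_diag ?n (($) y) = mat_diag ?n (glue_fun m (($) u) (($) v))"
    by (rule mat_diag_cong) (simp add: y_def)
  then have "?S = mat_diag ?n (($) y) - maxcut_cost ?n ?G ?w"
    using u v unfolding maxcut_cost_vertex_sum[OF G1 G2]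
    by (simp add: dual_feasible_def diag_minus_glue_dual[OF C1 C2] del: add_Suc_right)
  moreover have "psd_mat ?n ?S"
    using u v by (intro psd_mat_glue_dual) (auto simp: dual_feasible_def)
  ultimately have feasible: "dual_feasible ?n ?G ?w y ?S"
    by (simp add: dual_feasible_def y_def)
  have y_sum: "(\<Sum>i<?n. y $ i) = (\<Sum>i<Suc m. u $ i) + (\<Sum>i<Suc p. v $ i)"
    unfolding sum_glue_fun[symmetric] by (intro sum.cong) (auto simp: y_def)
  have "(\<Sum>i<?n. y $ i) \<le> (\<Sum>i<?n. z $ i)" if z: "dual_feasible ?n ?G ?w z T" for z T
  proof -
    \<comment> \<open>The whole shared coordinate of \<open>z\<close> goes to the first part and 0
      to the second. The division is arbitrary, since the shift by \<open>c\<close> corrects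
      it.\<close>
    define f where "f = ($) z"
    define g where "g i = (if i = 0 then 0 else z $ (i + m))" for i
    have fg: "glue_fun m f g i = z $ i" if "i < ?n" for i
      using that by (auto simp: glue_fun_def f_def g_def)
    have "T = mat_diag ?n (glue_fun m f g) - glue_dual (Suc m) (Suc p) ?C1 ?C2"
      using z mat_diag_cong[of ?n "glue_fun m f g" "($) z"] fg
      unfolding dual_feasible_def maxcut_cost_vertex_sum[OF G1 G2] by simp
    then have "psd_mat ?n (glue_dual (Suc m) (Suc p) (mat_diag (Suc m) f - ?C1) (mat_diag (Suc p) g - ?C2))"
      using z unfolding dual_feasible_def diag_minus_glue_dual[OF C1 C2] by blast
    then obtain c where
      psd1: "psd_mat (Suc m)
        (mat_diag (Suc m) f - ?C1 + mat_diag (Suc m) (\<lambda>i. if i = m then - c else 0))" and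
      psd2: "psd_mat (Suc p)
        (mat_diag (Suc p) g - ?C2 + mat_diag (Suc p) (\<lambda>i. if i = 0 then c else 0))"
      using C1 C2 sym[OF C1 transpose_maxcut_cost[OF G1]] sym[OF C2 transpose_maxcut_cost[OF G2]]
      by (elim psd_mat_glue_dual_split[rotated 4]) (auto simp: mat_diag_def)
    define u' where "u' = vec (Suc m) (\<lambda>i. f i + (if i = m then - c else 0))"
    define v' where "v' = vec (Suc p) (\<lambda>i. g i + (if i = 0 then c else 0))"
    have "dual_feasible (Suc m) G1 w1 u' (mat_diag (Suc m) (($) u') - ?C1)"
      using psd1 unfolding diag_minus_add_diag[OF C1] by (simp add: dual_feasible_def u'_def)
    moreover have "dual_feasible (Suc p) G2 w2 v' (mat_diag (Suc p) (($) v') - ?C2)"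
      using psd2 unfolding diag_minus_add_diag[OF C2] by (simp add: dual_feasible_def v'_def)
    ultimately have "(\<Sum>i<Suc m. u $ i) + (\<Sum>i<Suc p. v $ i)
        \<le> (\<Sum>i<Suc m. u' $ i) + (\<Sum>i<Suc p. v' $ i)"
      by (intro add_mono u_opt v_opt)
    also have "\<dots> = (\<Sum>i<Suc m. f i + (if i = m then - c else 0))
        + (\<Sum>i<Suc p. g i + (if i = 0 then c else 0))"
      by (simp add: u'_def v'_def del: sum.lessThan_Suc)
    \<comment> \<open>The corrections \<open>- c\<close> at \<open>m\<close> and \<open>c\<close> at
      0 cancel in the total.\<close>
    also have "\<dots> = (\<Sum>i<Suc m. f i) + (\<Sum>i<Suc p. g i)"
      by (simp add: sum.distrib del: sum.lessThan_Suc)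
    also have "\<dots> = (\<Sum>i<?n. z $ i)"
      unfolding sum_glue_fun[symmetric] by (intro sum.cong) (auto simp: fg)
    finally show ?thesis unfolding y_sum .
  qed
  with feasible show ?thesis unfolding optimal_dual_solution_def by blast
qed

section \<open>The primal problem of a vertex sum\<close>

text \<open>\<open>V\<close> has the transpose of \<open>y2\<close> as its last row and zeros above,
  so \<open>X1 * V\<close> is the last column of \<open>X1\<close> times that row. As the corner
  entry of \<open>X1\<close> is 1, the lower right product is \<open>y2 * transpose_mat y2\<close>,
  which leaves the Schur complement of the leading 1 in the second primal matrix.\<close>

lemma glue_primal_eq_block:
  assumes Y1: "Y1 \<in> carrier_mat m m" and y1: "y1 \<in> carrier_mat m 1"
    and Y2: "Y2 \<in> carrier_mat p p" and y2: "y2 \<in> carrier_mat p 1"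
  defines "X1 \<equiv> four_block_mat Y1 y1 (transpose_mat y1) (1\<^sub>m 1)"
    and "V \<equiv> mat (Suc m) p (\<lambda>(i, j). if i = m then y2 $$ (j, 0) else 0)"
  shows "glue_primal Y1 y1 y2 Y2 = four_block_mat X1 (X1 * V) (transpose_mat V * X1)
    (transpose_mat V * X1 * V + (Y2 - y2 * transpose_mat y2))"
proof -
  have X1: "X1 \<in> carrier_mat (Suc m) (Suc m)" using Y1 y1 by (auto simp: X1_def)
  have V: "V \<in> carrier_mat (Suc m) p" by (simp add: V_def)
  have XV: "X1 * V = append_rows (y1 * transpose_mat y2) (transpose_mat y2)"
  proof (rule eq_matI)
    fix i j assume "i < dim_row (append_rows (y1 * transpose_mat y2) (transpose_mat y2))"
      "j < dim_col (append_rows (y1 * transpose_mat y2) (transpose_mat y2))"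
    then have ij: "i < Suc m" "j < p" using y1 y2 by (auto simp: append_rows_def)
    then have "(X1 * V) $$ (i, j) = (\<Sum>k<Suc m. if k = m then X1 $$ (i, m) * y2 $$ (j, 0) else 0)"
      using X1 V by (auto simp: scalar_prod_def lessThan_atLeast0 V_def intro!: sum.cong)
    then show "(X1 * V) $$ (i, j) = append_rows (y1 * transpose_mat y2) (transpose_mat y2) $$ (i, j)"
      using ij Y1 y1 y2 by (auto simp: append_rows_def X1_def scalar_prod_def less_Suc_eq)
  qed (use X1 V y1 y2 in \<open>auto simp: append_rows_def\<close>)
  have VX: "transpose_mat V * X1 = append_cols (y2 * transpose_mat y1) y2"
  proof (rule eq_matI)
    fix i j assume "i < dim_row (append_cols (y2 * transpose_mat y1) y2)"
      "j < dim_col (append_cols (y2 * transpose_mat y1) y2)"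
    then have ij: "i < p" "j < Suc m" using y1 y2 by (auto simp: append_cols_def)
    then have "(transpose_mat V * X1) $$ (i, j) = (\<Sum>k<Suc m. if k = m then y2 $$ (i, 0) * X1 $$ (m, j) else 0)"
      using X1 V by (auto simp: scalar_prod_def lessThan_atLeast0 V_def intro!: sum.cong)
    then show "(transpose_mat V * X1) $$ (i, j) = append_cols (y2 * transpose_mat y1) y2 $$ (i, j)"
      using ij Y1 y1 y2 by (auto simp: append_cols_def X1_def scalar_prod_def less_Suc_eq)
  qed (use X1 V y1 y2 in \<open>auto simp: append_cols_def\<close>)
  have "transpose_mat V * X1 * V = y2 * transpose_mat y2"
  proof (rule eq_matI)
    fix i j assume "i < dim_row (y2 * transpose_mat y2)" "j < dim_col (y2 * transpose_mat y2)"
    then have ij: "i < p" "j < p" using y2 by auto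
    have "(transpose_mat V * X1 * V) $$ (i, j)
        = (\<Sum>k<Suc m. if k = m then (transpose_mat V * X1) $$ (i, m) * y2 $$ (j, 0) else 0)"
      using ij X1 V by (auto simp: scalar_prod_def lessThan_atLeast0 V_def intro!: sum.cong)
    then show "(transpose_mat V * X1 * V) $$ (i, j) = (y2 * transpose_mat y2) $$ (i, j)"
      using ij y1 y2 unfolding VX by (auto simp: append_cols_def scalar_prod_def)
  qed (use X1 V y1 y2 in auto)
  then have "transpose_mat V * X1 * V + (Y2 - y2 * transpose_mat y2) = Y2"
    using Y2 y2 by (intro eq_matI) auto
  then show ?thesis by (simp add: glue_primal_def XV VX) (simp add: X1_def)
qed

theorem theorem3:
  fixes n1 n2 :: nat
    and G1 G2 :: "nat pair_pre_digraph"
    and w1 w2 :: "(nat \<times> nat) weight_fun"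
    and X1 S1 X2 S2 Y1 y1 Y2 y2 :: "real mat"
  assumes "0 < n1" and "0 < n2"
    and "weighted_graph n1 G1 w1"
    and "weighted_graph n2 G2 w2"
    and "optimal_primal_solution n1 G1 w1 X1" and "optimal_dual_solution n1 G1 w1 S1"
    and "optimal_primal_solution n2 G2 w2 X2" and "optimal_dual_solution n2 G2 w2 S2"
    and "Y1 \<in> carrier_mat (n1 - 1) (n1 - 1)" and "y1 \<in> carrier_mat (n1 - 1) 1"
    and "Y2 \<in> carrier_mat (n2 - 1) (n2 - 1)" and "y2 \<in> carrier_mat (n2 - 1) 1"
    and "X1 = four_block_mat Y1 y1
                             (transpose_mat y1) (1\<^sub>m 1)"
    and "X2 = four_block_mat (1\<^sub>m 1) (transpose_mat y2)
                             y2 Y2"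
  shows "optimal_primal_solution (n1 + n2 - 1)
           (vertex_sum n1 G1 G2) (vertex_sum_weight n1 G1 w1 w2) (glue_primal Y1 y1 y2 Y2)
       \<and> optimal_dual_solution (n1 + n2 - 1)
           (vertex_sum n1 G1 G2) (vertex_sum_weight n1 G1 w1 w2) (glue_dual n1 n2 S1 S2)
       \<and> int (vec_space.rank (n1 + n2 - 1) (glue_primal Y1 y1 y2 Y2))
           = int (vec_space.rank n1 X1) + int (vec_space.rank n2 X2) - 1"
proof -
  obtain m p where mp: "n1 = Suc m" "n2 = Suc p"
    using \<open>0 < n1\<close> \<open>0 < n2\<close> by (metis gr0_implies_Suc)
  then have n: "n1 + n2 - 1 = m + Suc p" by simp
  have Y1: "Y1 \<in> carrier_mat m m" and y1: "y1 \<in> carrier_mat m 1"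
    and Y2: "Y2 \<in> carrier_mat p p" and y2: "y2 \<in> carrier_mat p 1"
    using assms mp by auto
  note G1 = \<open>weighted_graph n1 G1 w1\<close>[unfolded mp] and G2 = \<open>weighted_graph n2 G2 w2\<close>[unfolded mp]
  let ?X = "glue_primal Y1 y1 y2 Y2"
  define B where "B = Y2 - y2 * transpose_mat y2"
  define V where "V = mat (Suc m) p (\<lambda>(i, j). if i = m then y2 $$ (j, 0) else 0)"
  have B: "B \<in> carrier_mat p p" and V: "V \<in> carrier_mat (Suc m) p"
    using Y2 y2 by (auto simp: B_def V_def intro: minus_carrier_mat)
  have X1: "X1 \<in> carrier_mat (Suc m) (Suc m)"
    using assms(13) four_block_carrier_mat[OF Y1 one_carrier_mat[of 1]] by simp
  have X2: "X2 \<in> carrier_mat (Suc p) (Suc p)"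
    using assms(14) four_block_carrier_mat[OF one_carrier_mat[of 1] Y2] by simp
  have X_block: "?X = four_block_mat X1 (X1 * V) (transpose_mat V * X1) (transpose_mat V * X1 * V + B)"
    using glue_primal_eq_block[OF Y1 y1 Y2 y2] assms by (simp add: B_def V_def)
  have "y2 * transpose_mat y2 + B = Y2"
    using Y2 y2 unfolding B_def by (intro eq_matI) auto
  \<comment> \<open>The same block pattern, with the identity of size 1 in place of
    \<open>X1\<close> and the transpose of \<open>y2\<close> in place of \<open>V\<close>; the
    remainder is again \<open>B\<close>, which links the two matrices.\<close>
  then have X2_block: "X2 = four_block_mat (1\<^sub>m 1) (1\<^sub>m 1 * transpose_mat y2)
      (transpose_mat (transpose_mat y2) * 1\<^sub>m 1)
      (transpose_mat (transpose_mat y2) * 1\<^sub>m 1 * transpose_mat y2 + B)"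
    using assms y2 by simp
  have y2t: "transpose_mat y2 \<in> carrier_mat 1 p" using y2 by simp
  have feasible1: "primal_feasible (Suc m) X1" and feasible2: "primal_feasible (Suc p) X2"
    using assms mp by (auto simp: optimal_primal_solution_def)
  have psd1: "psd_mat (Suc m) X1" and psd2: "psd_mat (1 + p) X2"
    using feasible1 feasible2 by (auto simp: primal_feasible_def)
  \<comment> \<open>Semidefiniteness of \<open>X2\<close> passes to the common remainder
    \<open>B\<close>, and together with that of \<open>X1\<close> back up to the glued
    matrix.\<close>
  have "psd_mat p B"
    using psd2 unfolding X2_block psd_mat_block[OF one_carrier_mat y2t B] by simp
  then have "psd_mat (Suc m + p) ?X"
    using psd1 unfolding X_block psd_mat_block[OF X1 V B] by simp
  then have psd: "psd_mat (m + Suc p) ?X" by simp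
  then have X: "?X \<in> carrier_mat (m + Suc p) (m + Suc p)" by (simp add: psd_mat_def)
  have sub1: "shifted_submatrix 0 (Suc m) ?X = X1"
    unfolding X_block using X1 V B by (intro eq_matI) (auto simp: shifted_submatrix_def)
  have sub2: "shifted_submatrix m (Suc p) ?X = X2"
    unfolding assms(14) glue_primal_def using Y1 y1 Y2 y2
    by (intro eq_matI) (auto simp: shifted_submatrix_def append_rows_def append_cols_def)
  \<comment> \<open>Every diagonal position lies in one of the two principal submatrices, which are
    \<open>X1\<close> and \<open>X2\<close>.\<close>
  have "?X $$ (i, i) = 1" if "i < m + Suc p" for i
  proof (cases "i < Suc m")
    case True
    then show ?thesis
      using feasible1 arg_cong[OF sub1, of "\<lambda>M. M $$ (i, i)"]
      by (simp add: primal_feasible_def shifted_submatrix_def)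
  next
    case False
    then show ?thesis
      using that feasible2 arg_cong[OF sub2, of "\<lambda>M. M $$ (i - m, i - m)"]
      by (simp add: primal_feasible_def shifted_submatrix_def)
  qed
  with psd have feasible: "primal_feasible (m + Suc p) ?X" by (simp add: primal_feasible_def)
  let ?G = "vertex_sum (Suc m) G1 G2" and ?w = "vertex_sum_weight (Suc m) G1 w1 w2"
  have trace: "mat_trace (maxcut_cost (m + Suc p) ?G ?w * Z)
      = mat_trace (maxcut_cost (Suc m) G1 w1 * shifted_submatrix 0 (Suc m) Z)
        + mat_trace (maxcut_cost (Suc p) G2 w2 * shifted_submatrix m (Suc p) Z)"
    if "Z \<in> carrier_mat (m + Suc p) (m + Suc p)" for Z
    unfolding maxcut_cost_vertex_sum[OF G1 G2]
    by (rule mat_trace_glue_dual[OF maxcut_cost_carrier maxcut_cost_carrier that])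
  \<comment> \<open>The two principal submatrices of a feasible \<open>Z\<close> compete with
    \<open>X1\<close> and \<open>X2\<close> separately; at the glued matrix both optima are attained
    at once.\<close>
  have "mat_trace (maxcut_cost (m + Suc p) ?G ?w * Z) \<le> mat_trace (maxcut_cost (m + Suc p) ?G ?w * ?X)"
    if Z: "primal_feasible (m + Suc p) Z" for Z
  proof -
    have "Z \<in> carrier_mat (m + Suc p) (m + Suc p)"
      using Z by (simp add: primal_feasible_def psd_mat_def)
    moreover have "primal_feasible (Suc m) (shifted_submatrix 0 (Suc m) Z)"
      "primal_feasible (Suc p) (shifted_submatrix m (Suc p) Z)"
      using Z by (auto intro: primal_feasible_shifted_submatrix)
    ultimately show ?thesis
      using assms(5,7) unfolding mp
      by (simp add: trace X sub1 sub2 optimal_primal_solution_def add_mono del: add_Suc_right)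
  qed
  with feasible have primal: "optimal_primal_solution (m + Suc p) ?G ?w ?X"
    by (simp add: optimal_primal_solution_def)
  have dual: "optimal_dual_solution (m + Suc p) ?G ?w (glue_dual (Suc m) (Suc p) S1 S2)"
    using optimal_dual_solution_vertex_sum[OF G1 G2] assms(6,8) unfolding mp by blast
  have "vec_space.rank 1 (1\<^sub>m 1 :: real mat) = 1"
    using rank_plus_kernel_dim[OF one_carrier_mat[of 1, where 'a = real]] kernel_one_mat(1)[of 1, where 'a = real]
    by simp
  \<comment> \<open>The leading 1 of \<open>X2\<close> accounts for one unit of rank. Eliminating
    the rank of \<open>B\<close> between this identity and the next produces the \<open>- 1\<close>
    of the rank formula.\<close>
  then have "vec_space.rank (1 + p) X2 = 1 + vec_space.rank p B"
    unfolding X2_block rank_block[OF one_carrier_mat y2t B] by simp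
  moreover have "vec_space.rank (Suc m + p) ?X = vec_space.rank (Suc m) X1 + vec_space.rank p B"
    unfolding X_block by (rule rank_block[OF X1 V B])
  ultimately have "int (vec_space.rank (m + Suc p) ?X)
      = int (vec_space.rank (Suc m) X1) + int (vec_space.rank (Suc p) X2) - 1"
    by simp
  with primal dual show ?thesis unfolding mp n by simp
qed

end
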